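(* Let $(X,T)$ be a topological dynamical system, let $A\ge0$ be a constant, and let $\Phi=(nA)_{n\in\mathbb N}$ (the sequence whose $n$-th term is the constant function $nA$ on $X$). Then (1) If $A=0$, then $PD_i(T,\mathbf 0)=D(T)$ for $i=1,2,3,4$. (2) If $A>0$ and $0\le D(T)\le1$, then $PD_i(T,\Phi)=1$ for $i=1,2,3,4$. (3) If $A>0$ and $D(T)>1$, then $PD_i(T,\Phi)=D(T)$ for $i=1,2,3,4$.
   Context: A topological dynamical system $(X,T)$ (or $(X,d,T)$) is a compact metric space $(X,d)$ with a continuous map $T:X\to X$. $\mathbf 0$ denotes the sequence with all terms identically $0$. $\mathbb N=\{1,2,\dots\}$. Let $\mathcal C_X$ be the set of finite open covers of $X$; for $\alpha\in\mathcal C_X$, $\bigvee_{i=0}^{n-1}T^{-i}\alpha=\{A_0\cap T^{-1}A_1\cap\dots\cap T^{-(n-1)}A_{n-1}:A_j\in\alpha\}$. Let $d_n(x,y)=\max_{0\le j<n}d(T^jx,T^jy)$. $F\subseteq X$ is $(n,\epsilon)$-spanning if for each $x\in X$ there is $y\in F$ with $d_n(x,y)<\epsilon$; $E\subseteq X$ is $(n,\epsilon)$-separated if $d_n(x,y)>\epsilon$ for all distinct $x,y\in E$. Let $s(n,\epsilon)$ be the minimal cardinality of an $(n,\epsilon)$-spanning set and $r(n,\epsilon)$ the maximal cardinality of an $(n,\epsilon)$-separated set. For a sequence $\Phi=(\varphi_n)_{n\in\mathbb N}$ of continuous real functions on $X$ put - $q_n(T,\Phi,\alpha)=\inf\{\sum_{B\in\beta}\inf_{x\in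 B}e^{\varphi_n(x)}:\beta\text{ a finite subcover of }\bigvee_{i=0}^{n-1}T^{-i}\alpha\}$, - $p_n(T,\Phi,\alpha)=\inf\{\sum_{B\in\beta}\sup_{x\in B}e^{\varphi_n(x)}:\beta\text{ a finite subcover of }\bigvee_{i=0}^{n-1}T^{-i}\alpha\}$, - $Q_n(T,\Phi,\epsilon)=\inf\{\sum_{x\in F}e^{\varphi_n(x)}:F\text{ is }(n,\epsilon)\text{-spanning}\}$, - $P_n(T,\Phi,\epsilon)=\sup\{\sum_{x\in E}e^{\varphi_n(x)}:E\text{ is }(n,\epsilon)\text{-separated}\}$. The $s$-topological pressures, with values in $[-\infty,+\infty]$, are $PD_1(s,T,\Phi)=\sup_{\alpha\in\mathcal C_X}\limsup_{n\to\infty}\frac1{n^s}\log q_n(T,\Phi,\alpha)$, $PD_2(s,T,\Phi)=\lim_{\epsilon\to0}\limsup_{n\to\infty}\frac1{n^s}\log Q_n(T,\Phi,\epsilon)$, $PD_3(s,T,\Phi)=\lim_{\epsilon\to0}\limsup_{n\to\infty}\frac1{n^s}\log P_n(T,\Phi,\epsilon)$, $PD_4(s,T,\Phi)=\sup_{\alpha\in\mathcal C_X}\limsup_{n\to\infty}\frac1{n^s}\log p_n(T,\Phi,\alpha)$. The topological pressure dimensions are $PD_i(T,\Phi)=\sup\{s>0:PD_i(s,T,\Phi)=\infty\}=\inf\{s>0:PD_i(s,T,\Phi)=0\}\in[0,+\infty]$, where "$=\infty$" means infinite ($+\infty$ or $-\infty$), $\sup\emptyset=0$ and $\inf\emptyset=+\infty$.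 The $s$-topological entropy is $D(s,T)=\lim_{\epsilon\to0}\limsup_{n\to\infty}\frac1{n^s}\log s(n,\epsilon)=\lim_{\epsilon\to0}\limsup_{n\to\infty}\frac1{n^s}\log r(n,\epsilon)$, and the topological entropy dimension is $D(T)=\sup\{s>0:D(s,T)=\infty\}=\inf\{s>0:D(s,T)=0\}$ (same conventions). *)

theory Defs
  imports "HOL-Analysis.Analysis"
begin

text \<open>The compact metric space is the universe of a type of class \<open>metric_space\<close> (hence nonempty),
  assumed compact where needed. Sequences of potentials are indexed by \<open>nat\<close>; all quantities
  below enter only through a \<open>limsup\<close> in \<open>n\<close>, so their values at \<open>n = 0\<close> are irrelevant.\<close>

definition finite_open_covers :: "'a::topological_space set set set" where
  "finite_open_covers = {\<alpha>. finite \<alpha> \<and> (\<forall>U\<in>\<alpha>. open U) \<and> \<Union>\<alpha> = UNIV}"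

definition iterated_join :: "('a \<Rightarrow> 'a) \<Rightarrow> 'a set set \<Rightarrow> nat \<Rightarrow> 'a set set" where
  "iterated_join T \<alpha> n = {\<Inter>i<n. (T ^^ i) -` A i | A. \<forall>i<n. A i \<in> \<alpha>}"

definition finite_subcovers :: "'a set set \<Rightarrow> 'a set set set" where
  "finite_subcovers \<gamma> = {\<beta>. finite \<beta> \<and> \<beta> \<subseteq> \<gamma> \<and> \<Union>\<beta> = UNIV}"

definition bowen_dist :: "('a::metric_space \<Rightarrow> 'a) \<Rightarrow> nat \<Rightarrow> 'a \<Rightarrow> 'a \<Rightarrow> real" where
  "bowen_dist T n x y = Max ((\<lambda>j. dist ((T ^^ j) x) ((T ^^ j) y)) ` {..<n})"

definition spanning :: "('a::metric_space \<Rightarrow> 'a) \<Rightarrow> nat \<Rightarrow> real \<Rightarrow> 'a set \<Rightarrow> bool" where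
  "spanning T n \<epsilon> F \<longleftrightarrow> (\<forall>x. \<exists>y\<in>F. bowen_dist T n x y < \<epsilon>)"

definition separated :: "('a::metric_space \<Rightarrow> 'a) \<Rightarrow> nat \<Rightarrow> real \<Rightarrow> 'a set \<Rightarrow> bool" where
  "separated T n \<epsilon> E \<longleftrightarrow> (\<forall>x\<in>E. \<forall>y\<in>E. x \<noteq> y \<longrightarrow> bowen_dist T n x y > \<epsilon>)"

text \<open>Sums of exponentials are taken in \<^typ>\<open>ennreal\<close>: an infinite spanning set then contributes
  its genuine (infinite) sum, and an empty member of a subcover contributes \<open>top\<close> as an infimum
  and \<open>0\<close> as a supremum. As empty members can be discarded from a cover, they affect
  neither \<open>cover_inf_sum\<close> nor \<open>cover_sup_sum\<close>.\<close>

definition cover_inf_sum ::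
  "('a \<Rightarrow> 'a) \<Rightarrow> (nat \<Rightarrow> 'a \<Rightarrow> real) \<Rightarrow> nat \<Rightarrow> 'a set set \<Rightarrow> ennreal" where
  "cover_inf_sum T \<Phi> n \<alpha> =
    (INF \<beta>\<in>finite_subcovers (iterated_join T \<alpha> n). \<Sum>B\<in>\<beta>. INF x\<in>B. ennreal (exp (\<Phi> n x)))"

definition cover_sup_sum ::
  "('a \<Rightarrow> 'a) \<Rightarrow> (nat \<Rightarrow> 'a \<Rightarrow> real) \<Rightarrow> nat \<Rightarrow> 'a set set \<Rightarrow> ennreal" where
  "cover_sup_sum T \<Phi> n \<alpha> =
    (INF \<beta>\<in>finite_subcovers (iterated_join T \<alpha> n). \<Sum>B\<in>\<beta>. SUP x\<in>B. ennreal (exp (\<Phi> n x)))"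

definition spanning_sum ::
  "('a::metric_space \<Rightarrow> 'a) \<Rightarrow> (nat \<Rightarrow> 'a \<Rightarrow> real) \<Rightarrow> nat \<Rightarrow> real \<Rightarrow> ennreal" where
  "spanning_sum T \<Phi> n \<epsilon> =
    (INF F\<in>{F. spanning T n \<epsilon> F}. \<Sum>\<^sub>\<infinity>x\<in>F. ennreal (exp (\<Phi> n x)))"

definition separated_sum ::
  "('a::metric_space \<Rightarrow> 'a) \<Rightarrow> (nat \<Rightarrow> 'a \<Rightarrow> real) \<Rightarrow> nat \<Rightarrow> real \<Rightarrow> ennreal" where
  "separated_sum T \<Phi> n \<epsilon> =
    (SUP E\<in>{E. separated T n \<epsilon> E}. \<Sum>\<^sub>\<infinity>x\<in>E. ennreal (exp (\<Phi> n x)))"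

definition ext_ln :: "ennreal \<Rightarrow> ereal" where
  "ext_ln x = (if x = 0 then -\<infinity> else if x = top then \<infinity> else ereal (ln (enn2real x)))"

definition growth_rate :: "real \<Rightarrow> (nat \<Rightarrow> ennreal) \<Rightarrow> ereal" where
  "growth_rate s a = limsup (\<lambda>n. ereal (1 / real n powr s) * ext_ln (a n))"

definition s_pressure1 ::
  "real \<Rightarrow> ('a::metric_space \<Rightarrow> 'a) \<Rightarrow> (nat \<Rightarrow> 'a \<Rightarrow> real) \<Rightarrow> ereal" where
  "s_pressure1 s T \<Phi> = (SUP \<alpha>\<in>finite_open_covers. growth_rate s (\<lambda>n. cover_inf_sum T \<Phi> n \<alpha>))"

definition s_pressure2 ::
  "real \<Rightarrow> ('a::metric_space \<Rightarrow> 'a) \<Rightarrow> (nat \<Rightarrow> 'a \<Rightarrow> real) \<Rightarrow> ereal" where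
  "s_pressure2 s T \<Phi> = Lim (at_right 0) (\<lambda>\<epsilon>. growth_rate s (\<lambda>n. spanning_sum T \<Phi> n \<epsilon>))"

definition s_pressure3 ::
  "real \<Rightarrow> ('a::metric_space \<Rightarrow> 'a) \<Rightarrow> (nat \<Rightarrow> 'a \<Rightarrow> real) \<Rightarrow> ereal" where
  "s_pressure3 s T \<Phi> = Lim (at_right 0) (\<lambda>\<epsilon>. growth_rate s (\<lambda>n. separated_sum T \<Phi> n \<epsilon>))"

definition s_pressure4 ::
  "real \<Rightarrow> ('a::metric_space \<Rightarrow> 'a) \<Rightarrow> (nat \<Rightarrow> 'a \<Rightarrow> real) \<Rightarrow> ereal" where
  "s_pressure4 s T \<Phi> = (SUP \<alpha>\<in>finite_open_covers. growth_rate s (\<lambda>n. cover_sup_sum T \<Phi> n \<alpha>))"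

text \<open>The supremum is taken in \<^typ>\<open>ennreal\<close>, so that the supremum of the empty set is \<open>0\<close>.
  The absolute value makes both \<open>\<infinity>\<close> and \<open>-\<infinity>\<close> count as infinite.\<close>

definition critical_exponent :: "(real \<Rightarrow> ereal) \<Rightarrow> ennreal" where
  "critical_exponent f = (SUP s\<in>{s. 0 < s \<and> \<bar>f s\<bar> = \<infinity>}. ennreal s)"

definition pressure_dim1 :: "('a::metric_space \<Rightarrow> 'a) \<Rightarrow> (nat \<Rightarrow> 'a \<Rightarrow> real) \<Rightarrow> ennreal" where
  "pressure_dim1 T \<Phi> = critical_exponent (\<lambda>s. s_pressure1 s T \<Phi>)"

definition pressure_dim2 :: "('a::metric_space \<Rightarrow> 'a) \<Rightarrow> (nat \<Rightarrow> 'a \<Rightarrow> real) \<Rightarrow> ennreal" where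
  "pressure_dim2 T \<Phi> = critical_exponent (\<lambda>s. s_pressure2 s T \<Phi>)"

definition pressure_dim3 :: "('a::metric_space \<Rightarrow> 'a) \<Rightarrow> (nat \<Rightarrow> 'a \<Rightarrow> real) \<Rightarrow> ennreal" where
  "pressure_dim3 T \<Phi> = critical_exponent (\<lambda>s. s_pressure3 s T \<Phi>)"

definition pressure_dim4 :: "('a::metric_space \<Rightarrow> 'a) \<Rightarrow> (nat \<Rightarrow> 'a \<Rightarrow> real) \<Rightarrow> ennreal" where
  "pressure_dim4 T \<Phi> = critical_exponent (\<lambda>s. s_pressure4 s T \<Phi>)"

text \<open>Finite spanning sets exist when the space is compact, \<open>T\<close> is continuous and \<open>\<epsilon> > 0\<close>.\<close>

definition spanning_number :: "('a::metric_space \<Rightarrow> 'a) \<Rightarrow> nat \<Rightarrow> real \<Rightarrow> nat" where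
  "spanning_number T n \<epsilon> = (LEAST k. \<exists>F. finite F \<and> card F = k \<and> spanning T n \<epsilon> F)"

definition s_entropy :: "real \<Rightarrow> ('a::metric_space \<Rightarrow> 'a) \<Rightarrow> ereal" where
  "s_entropy s T =
    Lim (at_right 0) (\<lambda>\<epsilon>. growth_rate s (\<lambda>n. of_nat (spanning_number T n \<epsilon>)))"

definition entropy_dim :: "('a::metric_space \<Rightarrow> 'a) \<Rightarrow> ennreal" where
  "entropy_dim T = critical_exponent (\<lambda>s. s_entropy s T)"

end

theory Submission
  imports Defs "HOL-Real_Asymp.Real_Asymp"
begin

text \<open>For a potential \<open>\<Phi>\<^sub>n\<close> that is constant on the space, each of the four sums is \<open>e\<close> to that constant
  times a count (minimal subcover, minimal spanning set, maximal separated set), and Bowen's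
  comparison of these counts makes all four \<open>s\<close>-pressures equal to the pressure computed from
  spanning numbers. With \<open>\<Phi>\<^sub>n = n A\<close> and \<open>A > 0\<close>, the extra term \<open>n A / n\<^sup>s\<close> tends to infinity for
  \<open>s < 1\<close> and to \<open>0\<close> for \<open>s > 1\<close>, so the pressure is infinite below \<open>1\<close> and agrees with the
  \<open>s\<close>-entropy above \<open>1\<close>: the pressure dimension is \<open>max 1 (D(T))\<close>.\<close>

section \<open>Bowen distances, spanning sets and separated sets\<close>

text \<open>\<open>Max\<close> ranges over the indices below \<open>n\<close>, a nonempty set only
  for positive \<open>n\<close>; this is the source of the assumption \<open>0 < n\<close> that
  recurs below.\<close>

lemma bowen_dist_less_iff:
  assumes "0 < n"
  shows "bowen_dist T n x y < e \<longleftrightarrow> (\<forall>j<n. dist ((T ^^ j) x) ((T ^^ j) y) < e)"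
  unfolding bowen_dist_def using assms by (subst Max_less_iff) auto

lemma bowen_dist_commute: "bowen_dist T n x y = bowen_dist T n y x"
  by (simp add: bowen_dist_def dist_commute)

lemma bowen_dist_refl: "0 < n \<Longrightarrow> 0 < e \<Longrightarrow> bowen_dist T n x x < e"
  by (simp add: bowen_dist_less_iff)

lemma bowen_dist_triangle_half:
  assumes "0 < n" "bowen_dist T n x z < e / 2" "bowen_dist T n y z < e / 2"
  shows "bowen_dist T n x y < e"
  using assms(2,3) unfolding bowen_dist_less_iff[OF assms(1)] by (blast intro: dist_triangle_half_l)

lemma spanning_mono: "spanning T n \<delta> F \<Longrightarrow> \<delta> \<le> \<epsilon> \<Longrightarrow> spanning T n \<epsilon> F"
  unfolding spanning_def by (meson less_le_trans)

lemma separated_antimono: "separated T n \<epsilon> E \<Longrightarrow> \<delta> \<le> \<epsilon> \<Longrightarrow> separated T n \<delta> E"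
  unfolding separated_def by (meson le_less_trans)

lemma spanning_number_le: "finite F \<Longrightarrow> spanning T n \<epsilon> F \<Longrightarrow> spanning_number T n \<epsilon> \<le> card F"
  unfolding spanning_number_def by (rule Least_le) blast

lemma continuous_on_funpow:
  fixes T :: "'a::topological_space \<Rightarrow> 'a"
  assumes "continuous_on UNIV T"
  shows "continuous_on UNIV (T ^^ j)"
proof (induction j)
  case (Suc j)
  have "continuous_on ((T ^^ j) ` UNIV) T"
    using assms by (rule continuous_on_subset) simp
  then show ?case
    using continuous_on_compose[OF Suc] by simp
qed (simp add: id_def)

text \<open>A Bowen ball is a finite intersection of preimages of metric balls under the continuous
  iterates of \<open>T\<close>, hence open. By compactness finitely many of them cover the space,
  and their centres span.\<close>

lemma ex_finite_spanning:
  fixes T :: "'a::metric_space \<Rightarrow> 'a"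
  assumes "compact (UNIV :: 'a set)" "continuous_on UNIV T" "0 < n" "0 < \<epsilon>"
  shows "\<exists>F. finite F \<and> spanning T n \<epsilon> F"
proof -
  define B where "B y = {x. bowen_dist T n x y < \<epsilon>}" for y
  have B_eq: "B y = (\<Inter>j<n. (T ^^ j) -` ball ((T ^^ j) y) \<epsilon>)" for y
    using \<open>0 < n\<close> by (auto simp: B_def bowen_dist_less_iff dist_commute)
  have "open ((T ^^ j) -` ball z \<epsilon>)" for j z
    using continuous_on_funpow[OF assms(2)] by (rule open_vimage[OF open_ball])
  then have "open (B y)" for y
    unfolding B_eq by (intro open_INT) auto
  moreover have "y \<in> B y" for y
    using assms by (simp add: B_def bowen_dist_refl)
  then have "UNIV \<subseteq> (\<Union>y\<in>UNIV. B y)" by blast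
  ultimately obtain F where "finite F" "UNIV \<subseteq> (\<Union>y\<in>F. B y)"
    by (rule compactE_image[OF assms(1)])
  then show ?thesis
    unfolding spanning_def B_def by blast
qed

lemma ex_minimal_spanning:
  fixes T :: "'a::metric_space \<Rightarrow> 'a"
  assumes "compact (UNIV :: 'a set)" "continuous_on UNIV T" "0 < n" "0 < \<epsilon>"
  obtains F where "finite F" "card F = spanning_number T n \<epsilon>" "spanning T n \<epsilon> F"
proof -
  have "\<exists>F. finite F \<and> card F = spanning_number T n \<epsilon> \<and> spanning T n \<epsilon> F"
    unfolding spanning_number_def by (rule LeastI_ex) (use ex_finite_spanning[OF assms] in blast)
  with that show ?thesis by blast
qed

text \<open>The space is inhabited, so the empty set spans nothing. Positivity later keeps
  logarithms of counts real and nonnegative.\<close>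

lemma spanning_number_pos:
  fixes T :: "'a::metric_space \<Rightarrow> 'a"
  assumes "compact (UNIV :: 'a set)" "continuous_on UNIV T" "0 < n" "0 < \<epsilon>"
  shows "0 < spanning_number T n \<epsilon>"
proof -
  obtain F where "finite F" "card F = spanning_number T n \<epsilon>" "spanning T n \<epsilon> F"
    using ex_minimal_spanning[OF assms] .
  moreover from this have "F \<noteq> {}"
    by (auto simp: spanning_def)
  ultimately show ?thesis
    by (metis card_gt_0_iff)
qed

lemma spanning_number_antimono:
  fixes T :: "'a::metric_space \<Rightarrow> 'a"
  assumes "compact (UNIV :: 'a set)" "continuous_on UNIV T" "0 < n" "0 < \<delta>" "\<delta> \<le> \<epsilon>"
  shows "spanning_number T n \<epsilon> \<le> spanning_number T n \<delta>"
proof -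
  obtain F where "finite F" "card F = spanning_number T n \<delta>" "spanning T n \<delta> F"
    using ex_minimal_spanning[OF assms(1-4)] .
  then show ?thesis
    using spanning_number_le spanning_mono[OF _ \<open>\<delta> \<le> \<epsilon>\<close>] by metis
qed

text \<open>Send each point of \<open>E\<close> to a point of a minimal spanning set within
  \<open>\<epsilon> / 2\<close>. Two points of \<open>E\<close> with the same image would be closer
  than \<open>\<epsilon>\<close>, so this map is injective.\<close>

lemma separated_card_le:
  fixes T :: "'a::metric_space \<Rightarrow> 'a"
  assumes "compact (UNIV :: 'a set)" "continuous_on UNIV T" "0 < n" "0 < \<epsilon>"
    and "separated T n \<epsilon> E"
  shows "finite E" "card E \<le> spanning_number T n (\<epsilon> / 2)"
proof -
  obtain F where F: "finite F" "card F = spanning_number T n (\<epsilon> / 2)" "spanning T n (\<epsilon> / 2) F"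
    using ex_minimal_spanning[of T n "\<epsilon> / 2"] assms by auto
  from F(3) obtain g where g: "\<And>x. g x \<in> F" "\<And>x. bowen_dist T n x (g x) < \<epsilon> / 2"
    unfolding spanning_def by metis
  have "inj_on g E"
  proof (rule inj_onI, rule ccontr)
    fix x y assume *: "x \<in> E" "y \<in> E" "g x = g y" "x \<noteq> y"
    have "bowen_dist T n x y < \<epsilon>"
      using bowen_dist_triangle_half[OF \<open>0 < n\<close> g(2)[of x]] g(2)[of y] * by simp
    moreover have "\<epsilon> < bowen_dist T n x y"
      using assms(5) * by (simp add: separated_def)
    ultimately show False by simp
  qed
  moreover have "g ` E \<subseteq> F" using g by auto
  ultimately show "finite E" "card E \<le> spanning_number T n (\<epsilon> / 2)"
    using F inj_on_finite card_inj_on_le by metis+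
qed

text \<open>A separated set of maximal cardinality spans at every larger scale, since a point it
  missed could be added to it. The gap \<open>\<epsilon> < \<delta>\<close> is there because
  separation and spanning both use strict inequalities: a missed point is only known to be at
  distance at least \<open>\<delta>\<close>, while separation asks for more than
  \<open>\<epsilon>\<close>.\<close>

lemma ex_separated_card_ge:
  fixes T :: "'a::metric_space \<Rightarrow> 'a"
  assumes "compact (UNIV :: 'a set)" "continuous_on UNIV T" "0 < n" "0 < \<epsilon>" "\<epsilon> < \<delta>"
  obtains E where "finite E" "separated T n \<epsilon> E" "spanning_number T n \<delta> \<le> card E"
proof -
  \<comment> \<open>A maximum exists because the empty set is separated and all cardinalities lie
    strictly below the successor of a spanning number.\<close>
  have "\<exists>E. separated T n \<epsilon> E \<and> (\<forall>E'. separated T n \<epsilon> E' \<longrightarrow> card E' \<le> card E)"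
    using ex_has_greatest_nat[of "separated T n \<epsilon>" "{}" card "Suc (spanning_number T n (\<epsilon> / 2))"]
      separated_card_le(2)[OF assms(1-4)] by (force simp: separated_def less_Suc_eq_le)
  then obtain E where E: "separated T n \<epsilon> E" "\<And>E'. separated T n \<epsilon> E' \<Longrightarrow> card E' \<le> card E"
    by blast
  have fin: "finite E" using separated_card_le(1)[OF assms(1-4) E(1)] .
  have "spanning T n \<delta> E"
    unfolding spanning_def
  proof (rule allI, rule ccontr)
    fix x assume "\<not> (\<exists>y\<in>E. bowen_dist T n x y < \<delta>)"
    then have far: "\<epsilon> < bowen_dist T n x y \<and> \<epsilon> < bowen_dist T n y x" if "y \<in> E" for y
      using that assms(5) bowen_dist_commute[of T n x y] by force
    \<comment> \<open>Inserting \<open>x\<close> must really enlarge \<open>E\<close>: a point of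
      \<open>E\<close> would be at distance less than \<open>\<epsilon>\<close> from itself.\<close>
    then have "x \<notin> E" using bowen_dist_refl[OF assms(3,4)] by (meson less_asym)
    moreover have "separated T n \<epsilon> (insert x E)"
      using E(1) far by (auto simp: separated_def)
    ultimately show False
      using E(2) fin by fastforce
  qed
  then show ?thesis
    using that fin E(1) spanning_number_le by blast
qed

section \<open>Constant weights on spanning and separated sets\<close>

text \<open>With a constant weight, minimizing the sum means minimizing the number of points.
  Infinite spanning sets cannot lower the infimum, since a positive constant summed over them gives
  \<open>\<infinity>\<close>.\<close>

lemma spanning_sum_const:
  fixes T :: "'a::metric_space \<Rightarrow> 'a"
  assumes "compact (UNIV :: 'a set)" "continuous_on UNIV T" "0 < n" "0 < \<epsilon>"
  shows "spanning_sum T (\<lambda>n x. a n) n \<epsilon> = ennreal (exp (a n)) * of_nat (spanning_number T n \<epsilon>)"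
    (is "_ = ?c * _")
proof (rule antisym)
  obtain F where F: "finite F" "card F = spanning_number T n \<epsilon>" "spanning T n \<epsilon> F"
    using ex_minimal_spanning[OF assms] .
  have "spanning_sum T (\<lambda>n x. a n) n \<epsilon> \<le> (\<Sum>\<^sub>\<infinity>x\<in>F. ?c)"
    unfolding spanning_sum_def using F by (intro INF_lower) simp
  then show "spanning_sum T (\<lambda>n x. a n) n \<epsilon> \<le> ?c * of_nat (spanning_number T n \<epsilon>)"
    using F by (simp add: mult.commute)
  show "?c * of_nat (spanning_number T n \<epsilon>) \<le> spanning_sum T (\<lambda>n x. a n) n \<epsilon>"
    unfolding spanning_sum_def
  proof (rule INF_greatest)
    fix F assume F: "F \<in> {F. spanning T n \<epsilon> F}"
    show "?c * of_nat (spanning_number T n \<epsilon>) \<le> (\<Sum>\<^sub>\<infinity>x\<in>F. ?c)"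
    proof (cases "finite F")
      case True
      then have "of_nat (spanning_number T n \<epsilon>) \<le> (of_nat (card F) :: ennreal)"
        using F spanning_number_le by (metis mem_Collect_eq of_nat_mono)
      then have "?c * of_nat (spanning_number T n \<epsilon>) \<le> ?c * of_nat (card F)"
        by (rule mult_left_mono) simp
      then show ?thesis
        using True by (simp add: mult.commute)
    next
      case False
      then have "(\<Sum>\<^sub>\<infinity>x\<in>F. ?c) = \<infinity>"
        by (intro infsum_superconst_infinite_ennreal[where b = ?c]) auto
      then show ?thesis by simp
    qed
  qed
qed

text \<open>Together with the lower bound that follows, this traps the separated sum between
  spanning counts at different scales. The change of scale is harmless once a supremum over all
  scales is taken.\<close>

lemma separated_sum_const_le:
  fixes T :: "'a::metric_space \<Rightarrow> 'a"
  assumes "compact (UNIV :: 'a set)" "continuous_on UNIV T" "0 < n" "0 < \<epsilon>"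
  shows "separated_sum T (\<lambda>n x. a n) n \<epsilon> \<le>
    ennreal (exp (a n)) * of_nat (spanning_number T n (\<epsilon> / 2))" (is "_ \<le> ?c * _")
  unfolding separated_sum_def
proof (rule SUP_least)
  fix E assume "E \<in> {E. separated T n \<epsilon> E}"
  then have E: "finite E" "card E \<le> spanning_number T n (\<epsilon> / 2)"
    using separated_card_le[OF assms] by auto
  then have "of_nat (card E) \<le> (of_nat (spanning_number T n (\<epsilon> / 2)) :: ennreal)"
    by (intro of_nat_mono)
  then have "?c * of_nat (card E) \<le> ?c * of_nat (spanning_number T n (\<epsilon> / 2))"
    by (rule mult_left_mono) simp
  then show "(\<Sum>\<^sub>\<infinity>x\<in>E. ?c) \<le> ?c * of_nat (spanning_number T n (\<epsilon> / 2))"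
    using E by (simp add: mult.commute)
qed

lemma separated_sum_const_ge:
  fixes T :: "'a::metric_space \<Rightarrow> 'a"
  assumes "compact (UNIV :: 'a set)" "continuous_on UNIV T" "0 < n" "0 < \<epsilon>" "\<epsilon> < \<delta>"
  shows "ennreal (exp (a n)) * of_nat (spanning_number T n \<delta>) \<le> separated_sum T (\<lambda>n x. a n) n \<epsilon>"
    (is "?c * _ \<le> _")
proof -
  obtain E where E: "finite E" "separated T n \<epsilon> E" "spanning_number T n \<delta> \<le> card E"
    using ex_separated_card_ge[OF assms] .
  have "?c * of_nat (spanning_number T n \<delta>) \<le> ?c * of_nat (card E)"
    using E(3) by (intro mult_left_mono of_nat_mono) auto
  also have "\<dots> = (\<Sum>\<^sub>\<infinity>x\<in>E. ?c)"
    using E by (simp add: mult.commute)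
  also have "\<dots> \<le> separated_sum T (\<lambda>n x. a n) n \<epsilon>"
    unfolding separated_sum_def using E by (intro SUP_upper) simp
  finally show ?thesis .
qed

lemma separated_sum_antimono:
  "\<delta> \<le> \<epsilon> \<Longrightarrow> separated_sum T \<Phi> n \<epsilon> \<le> separated_sum T \<Phi> n \<delta>"
  unfolding separated_sum_def by (intro SUP_subset_mono) (auto intro: separated_antimono)

section \<open>Constant weights on subcovers of iterated joins\<close>

text \<open>The weight \<open>w\<close> stands for either the infimum or the supremum of a constant over a cover
  member; these differ only on the empty set.\<close>

lemma cover_sum_le_spanning:
  fixes T :: "'a::metric_space \<Rightarrow> 'a"
  assumes "compact (UNIV :: 'a set)" "continuous_on UNIV T" "\<alpha> \<in> finite_open_covers"
  obtains \<delta> where "0 < \<delta>" "\<And>n w (c::ennreal). 0 < n \<Longrightarrow> (\<And>B. B \<noteq> {} \<Longrightarrow> w B = c) \<Longrightarrow>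
    (INF \<beta>\<in>finite_subcovers (iterated_join T \<alpha> n). \<Sum>B\<in>\<beta>. w B) \<le> c * of_nat (spanning_number T n \<delta>)"
proof -
  have \<alpha>: "UNIV \<subseteq> \<Union>\<alpha>" "\<And>G. G \<in> \<alpha> \<Longrightarrow> open G"
    using assms(3) by (auto simp: finite_open_covers_def)
  \<comment> \<open>\<open>\<delta>\<close> is a Lebesgue number of the cover. It depends on
    \<open>\<alpha>\<close> alone, so one scale serves every \<open>n\<close>.\<close>
  obtain \<delta> where \<delta>: "0 < \<delta>" "\<And>x. x \<in> UNIV \<Longrightarrow> \<exists>G\<in>\<alpha>. ball x \<delta> \<subseteq> G"
    using Heine_Borel_lemma[OF assms(1) \<alpha>] by blast
  then obtain g where g: "\<And>x. g x \<in> \<alpha>" "\<And>x. ball x \<delta> \<subseteq> g x"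
    by (metis UNIV_I)
  show ?thesis
  proof (rule that[OF \<delta>(1)])
    fix n :: nat and w :: "'a set \<Rightarrow> ennreal" and c
    assume n: "0 < n" and w: "\<And>B. B \<noteq> {} \<Longrightarrow> w B = c"
    obtain F where F: "finite F" "card F = spanning_number T n \<delta>" "spanning T n \<delta> F"
      using ex_minimal_spanning[OF assms(1,2) n \<delta>(1)] .
    \<comment> \<open>\<open>B y\<close> follows the orbit of \<open>y\<close> through cover members
      that contain the \<open>\<delta>\<close>-balls around the orbit points; it therefore contains
      the Bowen ball around \<open>y\<close>.\<close>
    define B where "B y = (\<Inter>j<n. (T ^^ j) -` g ((T ^^ j) y))" for y
    have in_B: "x \<in> B y" if "bowen_dist T n x y < \<delta>" for x y
      using that n g(2) unfolding B_def bowen_dist_less_iff[OF n]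
      by (auto simp: dist_commute intro!: subsetD[OF g(2)])
    have "B y \<noteq> {}" for y
      using in_B[OF bowen_dist_refl[OF n \<delta>(1)]] by blast
    then have w': "w (B y) = c" for y by (rule w)
    have "B y \<in> iterated_join T \<alpha> n" for y
      unfolding iterated_join_def B_def using g(1) by auto
    moreover have "\<Union>(B ` F) = UNIV"
      using F(3) in_B unfolding spanning_def by blast
    ultimately have "B ` F \<in> finite_subcovers (iterated_join T \<alpha> n)"
      using F(1) by (auto simp: finite_subcovers_def)
    then have "(INF \<beta>\<in>finite_subcovers (iterated_join T \<alpha> n). \<Sum>B\<in>\<beta>. w B) \<le> (\<Sum>B\<in>B ` F. w B)"
      by (rule INF_lower)
    also have "\<dots> = (\<Sum>B\<in>B ` F. c)"
      by (rule sum.cong) (auto simp: w')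
    also have "\<dots> = c * of_nat (card (B ` F))"
      by (simp add: mult.commute)
    \<comment> \<open>Different centres may yield the same member of the join, so only an inequality
      holds here.\<close>
    also have "\<dots> \<le> c * of_nat (card F)"
      using F(1) by (intro mult_left_mono of_nat_mono card_image_le) auto
    finally show "(INF \<beta>\<in>finite_subcovers (iterated_join T \<alpha> n). \<Sum>B\<in>\<beta>. w B) \<le>
        c * of_nat (spanning_number T n \<delta>)"
      using F(2) by simp
  qed
qed

text \<open>Take a finite cover by balls of radius \<open>\<epsilon> / 2\<close>. Two points in one
  member of the iterated join stay within \<open>\<epsilon>\<close> of each other for
  \<open>n\<close> steps, so choosing one point from each nonempty member of a subcover gives a
  spanning set. The cover is fixed before \<open>n\<close>.\<close>

lemma spanning_le_cover_sum:
  fixes T :: "'a::metric_space \<Rightarrow> 'a"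
  assumes "compact (UNIV :: 'a set)" "0 < \<epsilon>"
  obtains \<alpha> where "\<alpha> \<in> finite_open_covers" "\<And>n w (c::ennreal). 0 < n \<Longrightarrow> (\<And>B. B \<noteq> {} \<Longrightarrow> w B = c) \<Longrightarrow>
    c * of_nat (spanning_number T n \<epsilon>) \<le> (INF \<beta>\<in>finite_subcovers (iterated_join T \<alpha> n). \<Sum>B\<in>\<beta>. w B)"
proof -
  have "x \<in> ball x (\<epsilon> / 2)" for x :: 'a
    using assms(2) by simp
  then have "UNIV \<subseteq> (\<Union>x\<in>UNIV. ball (x :: 'a) (\<epsilon> / 2))"
    by (intro subsetI UN_I[OF UNIV_I])
  then obtain C where C: "finite C" "UNIV \<subseteq> (\<Union>x\<in>C. ball (x :: 'a) (\<epsilon> / 2))"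
    by (rule compactE_image[OF assms(1) open_ball])
  define \<alpha> where "\<alpha> = (\<lambda>x. ball x (\<epsilon> / 2)) ` C"
  show ?thesis
  proof (rule that)
    show "\<alpha> \<in> finite_open_covers"
      unfolding finite_open_covers_def \<alpha>_def using C by auto
    fix n :: nat and w :: "'a set \<Rightarrow> ennreal" and c
    assume n: "0 < n" and w: "\<And>B. B \<noteq> {} \<Longrightarrow> w B = c"
    show "c * of_nat (spanning_number T n \<epsilon>) \<le>
        (INF \<beta>\<in>finite_subcovers (iterated_join T \<alpha> n). \<Sum>B\<in>\<beta>. w B)"
    proof (rule INF_greatest)
      fix \<beta> assume "\<beta> \<in> finite_subcovers (iterated_join T \<alpha> n)"
      then have \<beta>: "finite \<beta>" "\<beta> \<subseteq> iterated_join T \<alpha> n" "\<Union>\<beta> = UNIV"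
        by (auto simp: finite_subcovers_def)
      \<comment> \<open>The empty set offers no point to choose, and \<open>w\<close> is unknown on
        it. Dropping it can only decrease the sum, as weights in \<open>ennreal\<close> are
        nonnegative.\<close>
      define \<gamma> where "\<gamma> = \<beta> - {{}}"
      define F where "F = (\<lambda>B. SOME y. y \<in> B) ` \<gamma>"
      have small: "bowen_dist T n x y < \<epsilon>" if B: "B \<in> \<beta>" "x \<in> B" "y \<in> B" for x y B
      proof -
        have "B \<in> iterated_join T \<alpha> n" using B(1) \<beta>(2) by (rule rev_subsetD)
        then obtain G where G: "B = (\<Inter>i<n. (T ^^ i) -` G i)" "\<forall>i<n. G i \<in> \<alpha>"
          unfolding iterated_join_def by blast
        show ?thesis
          unfolding bowen_dist_less_iff[OF n]
        proof (intro allI impI)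
          fix j assume j: "j < n"
          then obtain z where "G j = ball z (\<epsilon> / 2)"
            using G(2) by (auto simp: \<alpha>_def)
          moreover have "(T ^^ j) x \<in> G j" "(T ^^ j) y \<in> G j"
            using B(2,3) j unfolding G(1) by simp_all
          ultimately have "dist z ((T ^^ j) x) < \<epsilon> / 2" "dist z ((T ^^ j) y) < \<epsilon> / 2"
            by simp_all
          then show "dist ((T ^^ j) x) ((T ^^ j) y) < \<epsilon>"
            by (rule dist_triangle_half_r)
        qed
      qed
      have "spanning T n \<epsilon> F"
        unfolding spanning_def
      proof
        fix x
        have "x \<in> \<Union>\<beta>" using \<beta>(3) by simp
        then obtain B where B: "B \<in> \<beta>" "x \<in> B" by (rule UnionE)
        then have "B \<in> \<gamma>" unfolding \<gamma>_def by blast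
        then have "(SOME y. y \<in> B) \<in> F" by (simp add: F_def)
        moreover have "(SOME y. y \<in> B) \<in> B" using B(2) by (rule someI)
        then have "bowen_dist T n x (SOME y. y \<in> B) < \<epsilon>" by (rule small[OF B])
        ultimately show "\<exists>y\<in>F. bowen_dist T n x y < \<epsilon>" by (rule rev_bexI)
      qed
      moreover have fin: "finite \<gamma>" "finite F" using \<beta>(1) by (auto simp: \<gamma>_def F_def)
      ultimately have "spanning_number T n \<epsilon> \<le> card F" by (intro spanning_number_le)
      also have "card F \<le> card \<gamma>" unfolding F_def using fin by (intro card_image_le)
      finally have "c * of_nat (spanning_number T n \<epsilon>) \<le> c * of_nat (card \<gamma>)"
        by (intro mult_left_mono of_nat_mono) auto
      also have "\<dots> = (\<Sum>B\<in>\<gamma>. w B)"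
        using w by (simp add: \<gamma>_def mult.commute)
      also have "\<dots> \<le> (\<Sum>B\<in>\<beta>. w B)"
        using \<beta>(1) by (intro sum_mono2) (auto simp: \<gamma>_def)
      finally show "c * of_nat (spanning_number T n \<epsilon>) \<le> (\<Sum>B\<in>\<beta>. w B)" .
    qed
  qed
qed

section \<open>Growth rates and the limit over scales\<close>

lemma ext_ln_mono: "a \<le> b \<Longrightarrow> ext_ln a \<le> ext_ln b"
  by (auto simp: ext_ln_def top_unique enn2real_mono enn2real_positive_iff top.not_eq_extremum
      zero_less_iff_neq_zero)

text \<open>The upper limit ignores \<open>n = 0\<close>, where Bowen distances are a maximum over
  the empty set; comparing positive indices is enough.\<close>

lemma growth_rate_mono:
  assumes "\<And>n. 0 < n \<Longrightarrow> a n \<le> b n"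
  shows "growth_rate s a \<le> growth_rate s b"
  unfolding growth_rate_def
  by (intro Limsup_mono eventually_mono[OF eventually_gt_at_top[of 0]] ereal_mult_left_mono
      ext_ln_mono assms) auto

lemma growth_rate_cong:
  assumes "\<And>n. 0 < n \<Longrightarrow> a n = b n"
  shows "growth_rate s a = growth_rate s b"
  using assms by (intro antisym growth_rate_mono) auto

text \<open>A quantity that grows as the scale shrinks converges to its supremum. Replacing limits
  by suprema lets pressures be compared by matching each scale with another scale or a
  cover.\<close>

lemma Lim_at_right_0_antimono:
  fixes f :: "real \<Rightarrow> ereal"
  assumes "\<And>\<delta> \<epsilon>. 0 < \<delta> \<Longrightarrow> \<delta> \<le> \<epsilon> \<Longrightarrow> f \<epsilon> \<le> f \<delta>"
  shows "Lim (at_right 0) f = (SUP \<epsilon>\<in>{0<..}. f \<epsilon>)"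
proof (rule tendsto_Lim, simp, rule order_tendstoI)
  fix l assume "l < (SUP \<epsilon>\<in>{0<..}. f \<epsilon>)"
  then obtain \<epsilon> where "0 < \<epsilon>" "l < f \<epsilon>" by (auto simp: less_SUP_iff)
  then show "\<forall>\<^sub>F \<delta> in at_right 0. l < f \<delta>"
    using assms by (auto simp: eventually_at_right_field intro!: exI[of _ \<epsilon>] intro: less_le_trans)
next
  fix u assume "(SUP \<epsilon>\<in>{0<..}. f \<epsilon>) < u"
  then have "f \<delta> < u" if "0 < \<delta>" for \<delta>
    using that by (auto intro: le_less_trans[OF SUP_upper])
  then show "\<forall>\<^sub>F \<delta> in at_right 0. f \<delta> < u"
    by (auto simp: eventually_at_right_field intro!: exI[of _ 1])
qed

section \<open>The common pressure of potentials that are constant on the space\<close>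

text \<open>This is the reference value to which all four pressures and the \<open>s\<close>-entropy
  reduce; \<open>a n\<close> is the value of the \<open>n\<close>-th potential.\<close>

definition const_pressure :: "real \<Rightarrow> ('a::metric_space \<Rightarrow> 'a) \<Rightarrow> (nat \<Rightarrow> real) \<Rightarrow> ereal" where
  "const_pressure s T a = (SUP \<epsilon>\<in>{0<..}.
    growth_rate s (\<lambda>n. ennreal (exp (a n)) * of_nat (spanning_number T n \<epsilon>)))"

lemma const_growth_rate_antimono:
  fixes T :: "'a::metric_space \<Rightarrow> 'a"
  assumes "compact (UNIV :: 'a set)" "continuous_on UNIV T" "0 < \<delta>" "\<delta> \<le> \<epsilon>"
  shows "growth_rate s (\<lambda>n. ennreal (exp (a n)) * of_nat (spanning_number T n \<epsilon>))
    \<le> growth_rate s (\<lambda>n. ennreal (exp (a n)) * of_nat (spanning_number T n \<delta>))"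
  using assms by (intro growth_rate_mono mult_left_mono of_nat_mono spanning_number_antimono) auto

text \<open>Each cover is dominated by a scale through its Lebesgue number, and each scale by a
  cover with small balls, so the two suprema coincide. Leaving \<open>w\<close> free on the empty
  set treats the infimum and supremum versions at once.\<close>

lemma cover_pressure_const:
  fixes T :: "'a::metric_space \<Rightarrow> 'a"
  assumes "compact (UNIV :: 'a set)" "continuous_on UNIV T"
    and w: "\<And>n B. B \<noteq> {} \<Longrightarrow> w n B = ennreal (exp (a n))"
  shows "(SUP \<alpha>\<in>finite_open_covers. growth_rate s (\<lambda>n.
      INF \<beta>\<in>finite_subcovers (iterated_join T \<alpha> n). \<Sum>B\<in>\<beta>. w n B)) = const_pressure s T a"
  unfolding const_pressure_def
proof (rule antisym; rule SUP_mono)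
  fix \<alpha> :: "'a set set" assume "\<alpha> \<in> finite_open_covers"
  then obtain \<delta> where \<delta>: "0 < \<delta>" "\<And>n w (c::ennreal). 0 < n \<Longrightarrow> (\<And>B. B \<noteq> {} \<Longrightarrow> w B = c) \<Longrightarrow>
    (INF \<beta>\<in>finite_subcovers (iterated_join T \<alpha> n). \<Sum>B\<in>\<beta>. w B) \<le> c * of_nat (spanning_number T n \<delta>)"
    using cover_sum_le_spanning[OF assms(1,2)] by blast
  then show "\<exists>\<epsilon>\<in>{0<..}. growth_rate s (\<lambda>n.
      INF \<beta>\<in>finite_subcovers (iterated_join T \<alpha> n). \<Sum>B\<in>\<beta>. w n B)
      \<le> growth_rate s (\<lambda>n. ennreal (exp (a n)) * of_nat (spanning_number T n \<epsilon>))"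
    by (intro bexI[of _ \<delta>] growth_rate_mono \<delta>(2) w) auto
next
  fix \<epsilon> :: real assume "\<epsilon> \<in> {0<..}"
  then have "0 < \<epsilon>" by simp
  obtain \<alpha> where \<alpha>: "\<alpha> \<in> finite_open_covers" "\<And>n w (c::ennreal). 0 < n \<Longrightarrow> (\<And>B. B \<noteq> {} \<Longrightarrow> w B = c) \<Longrightarrow>
    c * of_nat (spanning_number T n \<epsilon>) \<le> (INF \<beta>\<in>finite_subcovers (iterated_join T \<alpha> n). \<Sum>B\<in>\<beta>. w B)"
    using spanning_le_cover_sum[OF assms(1) \<open>0 < \<epsilon>\<close>] by metis
  then show "\<exists>\<alpha>\<in>finite_open_covers.
      growth_rate s (\<lambda>n. ennreal (exp (a n)) * of_nat (spanning_number T n \<epsilon>))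
      \<le> growth_rate s (\<lambda>n. INF \<beta>\<in>finite_subcovers (iterated_join T \<alpha> n). \<Sum>B\<in>\<beta>. w n B)"
    by (intro bexI[of _ \<alpha>] growth_rate_mono \<alpha>(2) w) auto
qed

text \<open>The first and fourth pressures are the two cover versions. The second agrees scale by
  scale with the reference value, and so does the entropy, where the weight is
  \<open>exp 0 = 1\<close>. The third needs a shift of scale.\<close>

lemma s_pressures_const:
  fixes T :: "'a::metric_space \<Rightarrow> 'a"
  assumes "compact (UNIV :: 'a set)" "continuous_on UNIV T"
  shows "s_pressure1 s T (\<lambda>n x. a n) = const_pressure s T a"
    and "s_pressure2 s T (\<lambda>n x. a n) = const_pressure s T a"
    and "s_pressure3 s T (\<lambda>n x. a n) = const_pressure s T a"
    and "s_pressure4 s T (\<lambda>n x. a n) = const_pressure s T a"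
    and "s_entropy s T = const_pressure s T (\<lambda>n. 0)"
proof -
  show "s_pressure1 s T (\<lambda>n x. a n) = const_pressure s T a"
    unfolding s_pressure1_def cover_inf_sum_def by (rule cover_pressure_const[OF assms]) simp
  show "s_pressure4 s T (\<lambda>n x. a n) = const_pressure s T a"
    unfolding s_pressure4_def cover_sup_sum_def by (rule cover_pressure_const[OF assms]) simp
  show "s_entropy s T = const_pressure s T (\<lambda>n. 0)"
    unfolding s_entropy_def const_pressure_def
    using const_growth_rate_antimono[OF assms, of _ _ s "\<lambda>n. 0"]
    by (subst Lim_at_right_0_antimono) auto
  have eq: "growth_rate s (\<lambda>n. spanning_sum T (\<lambda>n x. a n) n \<epsilon>) =
      growth_rate s (\<lambda>n. ennreal (exp (a n)) * of_nat (spanning_number T n \<epsilon>))" if "0 < \<epsilon>" for \<epsilon>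
    using that by (intro growth_rate_cong spanning_sum_const assms)
  have "s_pressure2 s T (\<lambda>n x. a n) =
      (SUP \<epsilon>\<in>{0<..}. growth_rate s (\<lambda>n. spanning_sum T (\<lambda>n x. a n) n \<epsilon>))"
    unfolding s_pressure2_def
    using const_growth_rate_antimono[OF assms] by (intro Lim_at_right_0_antimono) (auto simp: eq)
  then show "s_pressure2 s T (\<lambda>n x. a n) = const_pressure s T a"
    unfolding const_pressure_def by (simp add: eq)
  have "s_pressure3 s T (\<lambda>n x. a n) =
      (SUP \<epsilon>\<in>{0<..}. growth_rate s (\<lambda>n. separated_sum T (\<lambda>n x. a n) n \<epsilon>))"
    unfolding s_pressure3_def
    by (intro Lim_at_right_0_antimono growth_rate_mono separated_sum_antimono)
  also have "\<dots> = const_pressure s T a"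
    unfolding const_pressure_def
  \<comment> \<open>Halving the scale works both ways: separated sets at \<open>\<epsilon>\<close>
    are bounded by spanning numbers at \<open>\<epsilon> / 2\<close>, and spanning numbers at
    \<open>\<epsilon>\<close> by separated sets at \<open>\<epsilon> / 2\<close>.\<close>
  proof (rule antisym; rule SUP_mono)
    fix \<epsilon> :: real assume "\<epsilon> \<in> {0<..}"
    then show "\<exists>\<delta>\<in>{0<..}. growth_rate s (\<lambda>n. separated_sum T (\<lambda>n x. a n) n \<epsilon>)
        \<le> growth_rate s (\<lambda>n. ennreal (exp (a n)) * of_nat (spanning_number T n \<delta>))"
      by (intro bexI[of _ "\<epsilon> / 2"] growth_rate_mono separated_sum_const_le assms) auto
  next
    fix \<epsilon> :: real assume "\<epsilon> \<in> {0<..}"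
    then show "\<exists>\<delta>\<in>{0<..}.
        growth_rate s (\<lambda>n. ennreal (exp (a n)) * of_nat (spanning_number T n \<epsilon>))
        \<le> growth_rate s (\<lambda>n. separated_sum T (\<lambda>n x. a n) n \<delta>)"
      by (intro bexI[of _ "\<epsilon> / 2"] growth_rate_mono separated_sum_const_ge assms) auto
  qed
  finally show "s_pressure3 s T (\<lambda>n x. a n) = const_pressure s T a" .
qed

section \<open>The contribution of a linear potential\<close>

lemma ext_ln_exp_mult_of_nat:
  assumes "0 < k"
  shows "ext_ln (ennreal (exp b) * of_nat k) = ereal (b + ln (real k))"
proof -
  have "ennreal (exp b) * of_nat k = ennreal (exp b * real k)"
    by (simp add: ennreal_mult ennreal_of_nat_eq_real_of_nat)
  then show ?thesis
    using assms by (simp add: ext_ln_def ln_mult ennreal_eq_0_iff not_le)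
qed

text \<open>The logarithm splits the potential from the count. Positive counts make both summands
  real, so no \<open>\<infinity> - \<infinity>\<close> arises.\<close>

lemma growth_rate_exp_mult_of_nat:
  assumes "\<And>n. 0 < n \<Longrightarrow> 0 < k n"
  shows "growth_rate s (\<lambda>n. ennreal (exp (a n)) * of_nat (k n)) =
    limsup (\<lambda>n. ereal (a n / real n powr s) + ereal (ln (real (k n)) / real n powr s))"
  unfolding growth_rate_def
  by (intro Limsup_eq eventually_mono[OF eventually_gt_at_top[of 0]])
    (simp add: assms ext_ln_exp_mult_of_nat add_divide_distrib)

text \<open>Counts are at least one, so their logarithms may be dropped from below, leaving
  \<open>A\<close> times \<open>n\<close> to the power \<open>1 - s\<close>, which diverges. A
  single scale suffices; \<open>1\<close> is an arbitrary choice.\<close>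

lemma const_pressure_linear_lt_1:
  fixes T :: "'a::metric_space \<Rightarrow> 'a"
  assumes "compact (UNIV :: 'a set)" "continuous_on UNIV T" "0 < A" "s < 1"
  shows "const_pressure s T (\<lambda>n. real n * A) = \<infinity>"
proof -
  let ?g = "growth_rate s (\<lambda>n. ennreal (exp (real n * A)) * of_nat (spanning_number T n 1))"
  have "filterlim (\<lambda>n. real n * A / real n powr s) at_top sequentially"
    using assms(3,4) by real_asymp
  then have "(\<lambda>n. ereal (real n * A / real n powr s)) \<longlonglongrightarrow> \<infinity>"
    by (simp add: tendsto_PInfty_eq_at_top)
  then have "\<infinity> = limsup (\<lambda>n. ereal (real n * A / real n powr s))"
    by (simp add: lim_imp_Limsup)
  also have "\<dots> \<le> limsup (\<lambda>n. ereal (real n * A / real n powr s) +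
      ereal (ln (real (spanning_number T n 1)) / real n powr s))"
    using spanning_number_pos[OF assms(1,2)]
    by (intro Limsup_mono eventually_mono[OF eventually_gt_at_top[of 0]])
      (simp add: Suc_le_eq)
  also have "\<dots> = ?g"
    using spanning_number_pos[OF assms(1,2)] by (intro growth_rate_exp_mult_of_nat[symmetric]) simp
  also have "?g \<le> const_pressure s T (\<lambda>n. real n * A)"
    unfolding const_pressure_def by (intro SUP_upper) simp
  finally show ?thesis by simp
qed

text \<open>Now the potential term tends to \<open>0\<close>, and adding a null sequence does not
  change an upper limit. This holds at every scale separately.\<close>

lemma const_pressure_linear_gt_1:
  fixes T :: "'a::metric_space \<Rightarrow> 'a"
  assumes "compact (UNIV :: 'a set)" "continuous_on UNIV T" "1 < s"
  shows "const_pressure s T (\<lambda>n. real n * A) = const_pressure s T (\<lambda>n. 0)"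
  unfolding const_pressure_def
proof (rule SUP_cong[OF refl])
  fix \<epsilon> :: real assume "\<epsilon> \<in> {0<..}"
  then have pos: "0 < spanning_number T n \<epsilon>" if "0 < n" for n
    using that spanning_number_pos[OF assms(1,2)] by simp
  have "(\<lambda>n. real n / real n powr s) \<longlonglongrightarrow> 0"
    using assms(3) by real_asymp
  then have "(\<lambda>n. A * (real n / real n powr s)) \<longlonglongrightarrow> A * 0"
    by (intro tendsto_mult tendsto_const)
  then have null: "(\<lambda>n. ereal (real n * A / real n powr s)) \<longlonglongrightarrow> 0"
    by (simp add: mult.commute zero_ereal_def)
  have "limsup (\<lambda>n. ereal (real n * A / real n powr s) +
        ereal (ln (real (spanning_number T n \<epsilon>)) / real n powr s)) =
      limsup (\<lambda>n. ereal (ln (real (spanning_number T n \<epsilon>)) / real n powr s))"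
    using ereal_limsup_lim_add[OF null] by (simp del: plus_ereal.simps)
  then show "growth_rate s (\<lambda>n. ennreal (exp (real n * A)) * of_nat (spanning_number T n \<epsilon>)) =
      growth_rate s (\<lambda>n. ennreal (exp 0) * of_nat (spanning_number T n \<epsilon>))"
    by (subst (1 2) growth_rate_exp_mult_of_nat) (simp_all add: pos)
qed

section \<open>Passing from pressures to dimensions\<close>

text \<open>Exponents up to \<open>1\<close> contribute at most \<open>1\<close> to either supremum,
  and beyond \<open>1\<close> the two functions agree. The borderline \<open>s = 1\<close> is left
  open, as the pressure there may be finite.\<close>

lemma critical_exponent_max_1:
  assumes below: "\<And>s. 0 < s \<Longrightarrow> s < 1 \<Longrightarrow> \<bar>f s\<bar> = \<infinity>" and above: "\<And>s. 1 < s \<Longrightarrow> f s = g s"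
  shows "critical_exponent f = max 1 (critical_exponent g)"
proof (rule antisym)
  show "critical_exponent f \<le> max 1 (critical_exponent g)"
    unfolding critical_exponent_def
  proof (rule SUP_least)
    fix s assume s: "s \<in> {s. 0 < s \<and> \<bar>f s\<bar> = \<infinity>}"
    show "ennreal s \<le> max 1 (SUP s\<in>{s. 0 < s \<and> \<bar>g s\<bar> = \<infinity>}. ennreal s)"
    proof (cases "s \<le> 1")
      case True
      then show ?thesis by (simp add: max.coboundedI1)
    next
      case False
      with s above show ?thesis by (intro max.coboundedI2 SUP_upper) auto
    qed
  qed
  \<comment> \<open>Since \<open>1\<close> itself need not be critical, the bound comes from
    approximating it from below.\<close>
  have one: "1 \<le> critical_exponent f"
  proof (rule dense_le)
    fix y :: ennreal assume "y < 1"
    then obtain r where r: "y = ennreal r" "0 \<le> r" "r < 1"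
      by (cases y) auto
    \<comment> \<open>The midpoint of \<open>r\<close> and \<open>1\<close> is positive even for
      \<open>r = 0\<close> and still lies strictly below \<open>1\<close>.\<close>
    define s where "s = (r + 1) / 2"
    have "ennreal r \<le> ennreal s" using r by (intro ennreal_leI) (simp add: s_def)
    also have "\<dots> \<le> critical_exponent f"
      unfolding critical_exponent_def using r below[of s] by (intro SUP_upper) (simp add: s_def)
    finally show "y \<le> critical_exponent f" using r by simp
  qed
  moreover have "critical_exponent g \<le> critical_exponent f"
    unfolding critical_exponent_def[of g]
  proof (rule SUP_least)
    fix s assume s: "s \<in> {s. 0 < s \<and> \<bar>g s\<bar> = \<infinity>}"
    show "ennreal s \<le> critical_exponent f"
    proof (cases "s \<le> 1")
      case True
      then have "ennreal s \<le> 1" by simp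
      with one show ?thesis by (rule order_trans[rotated])
    next
      case False
      with s above show ?thesis unfolding critical_exponent_def by (intro SUP_upper) auto
    qed
  qed
  ultimately show "max 1 (critical_exponent g) \<le> critical_exponent f" by simp
qed

theorem theorem4p3:
  fixes T :: "'a::metric_space \<Rightarrow> 'a" and A :: real and \<Phi> :: "nat \<Rightarrow> 'a \<Rightarrow> real"
  assumes "compact (UNIV :: 'a set)"
    and "continuous_on UNIV T"
    and "A \<ge> 0"
    and "\<Phi> = (\<lambda>n x. real n * A)"
  shows "(A = 0 \<longrightarrow>
           pressure_dim1 T (\<lambda>n x. 0) = entropy_dim T \<and>
           pressure_dim2 T (\<lambda>n x. 0) = entropy_dim T \<and>
           pressure_dim3 T (\<lambda>n x. 0) = entropy_dim T \<and>
           pressure_dim4 T (\<lambda>n x. 0) = entropy_dim T) \<and>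
         (A > 0 \<and> 0 \<le> entropy_dim T \<and> entropy_dim T \<le> 1 \<longrightarrow>
           pressure_dim1 T \<Phi> = 1 \<and> pressure_dim2 T \<Phi> = 1 \<and>
           pressure_dim3 T \<Phi> = 1 \<and> pressure_dim4 T \<Phi> = 1) \<and>
         (A > 0 \<and> entropy_dim T > 1 \<longrightarrow>
           pressure_dim1 T \<Phi> = entropy_dim T \<and> pressure_dim2 T \<Phi> = entropy_dim T \<and>
           pressure_dim3 T \<Phi> = entropy_dim T \<and> pressure_dim4 T \<Phi> = entropy_dim T)"
proof -
  note pressures = s_pressures_const[OF assms(1,2)]
  note dims = pressure_dim1_def pressure_dim2_def pressure_dim3_def pressure_dim4_def
  have zero: "entropy_dim T = critical_exponent (\<lambda>s. const_pressure s T (\<lambda>n. 0))"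
    by (simp add: entropy_dim_def pressures)
  have "critical_exponent (\<lambda>s. const_pressure s T (\<lambda>n. real n * A)) = max 1 (entropy_dim T)"
    if "A > 0"
    unfolding zero using that const_pressure_linear_lt_1[OF assms(1,2)]
      const_pressure_linear_gt_1[OF assms(1,2)] by (intro critical_exponent_max_1) auto
  \<comment> \<open>The last two cases are the two branches of \<open>max 1 (entropy_dim T)\<close>;
    the case \<open>A = 0\<close> is the identity of pressures and entropy for the zero
    potential.\<close>
  then show ?thesis
    unfolding dims assms(4)
    using pressures(1-4)[of _ "\<lambda>n. 0"] pressures(1-4)[of _ "\<lambda>n. real n * A"] zero
    by (auto simp: max_def)
qed

end
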